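(* Let $Y$ be a Hausdorff topological space and let $X\subset Y$ be a subspace which is an $F_\sigma$-Lusin space. Then $X$ is a $C_{\sigma\delta}$-set in $Y$. More precisely, $X=A\cap B$ for some $G_\delta$-set $A\subset Y$ and some $F_{\sigma\delta}$-set $B\subset Y$.
   Context: A subset of a topological space is constructible if it belongs to the smallest algebra of subsets of the space containing all open sets. An $F_\sigma$-set is a countable union of closed sets; a $G_\delta$-set is a countable intersection of open sets; an $F_{\sigma\delta}$-set is a countable intersection of $F_\sigma$-sets; a $C_\sigma$-set is a countable union of constructible sets; a $C_{\sigma\delta}$-set is a countable intersection of $C_\sigma$-sets. A topological space is Polish if it is homeomorphic to a separable complete metric space. A space $X$ is $F_\sigma$-Lusin if it is the image of a Polish space $P$ under a continuous bijective map $f:P\to X$ whose inverse $f^{-1}:X\to P$ is $F_\sigma$-measurable, i.e. for every open $U\subset P$ the image $f(U)$ is an $F_\sigma$-set in $X$. *)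

theory Defs
  imports "HOL-Analysis.Analysis"
begin

text \<open>
  \<^const>\<open>fsigma_in\<close> and \<^const>\<open>gdelta_in\<close> are the library's $F_\sigma$- and $G_\delta$-sets. As in
  \<^const>\<open>gdelta_in\<close>, the operation \<^const>\<open>relative_to\<close> in the countable intersections below
  makes the empty intersection equal to the whole space.
\<close>

definition constructible_in :: "'a topology \<Rightarrow> 'a set \<Rightarrow> bool" where
  "constructible_in Y S \<longleftrightarrow>
     S \<in> \<Inter>{M. algebra (topspace Y) M \<and> {U. openin Y U} \<subseteq> M}"

definition fsigma_delta_in :: "'a topology \<Rightarrow> 'a set \<Rightarrow> bool" where
  "fsigma_delta_in Y = (countable intersection_of fsigma_in Y) relative_to topspace Y"

definition csigma_in :: "'a topology \<Rightarrow> 'a set \<Rightarrow> bool" where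
  "csigma_in Y = countable union_of constructible_in Y"

definition csigma_delta_in :: "'a topology \<Rightarrow> 'a set \<Rightarrow> bool" where
  "csigma_delta_in Y = (countable intersection_of csigma_in Y) relative_to topspace Y"

text \<open>
  Carrying a metric along a homeomorphism, the space itself carries the complete metric; see
  \<open>Polish_space_iff_homeomorphic\<close> below.
\<close>
definition Polish_space :: "'a topology \<Rightarrow> bool" where
  "Polish_space P \<longleftrightarrow> completely_metrizable_space P \<and> separable_space P"

definition fsigma_Lusin_map :: "'p topology \<Rightarrow> 'a topology \<Rightarrow> ('p \<Rightarrow> 'a) \<Rightarrow> bool" where
  "fsigma_Lusin_map P X f \<longleftrightarrow>
     continuous_map P X f \<and> bij_betw f (topspace P) (topspace X) \<and>
     (\<forall>U. openin P U \<longrightarrow> fsigma_in X (f ` U))"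

text \<open>
  HOL cannot quantify over the type of points of \<open>P\<close>; since \<open>P\<close> is in bijection with \<open>X\<close>, taking
  the type of points of \<open>X\<close> is no restriction (lemma \<open>fsigma_Lusin_spaceI\<close>).
\<close>
definition fsigma_Lusin_space :: "'a topology \<Rightarrow> bool" where
  "fsigma_Lusin_space X \<longleftrightarrow>
     (\<exists>(P :: 'a topology) f. Polish_space P \<and> fsigma_Lusin_map P X f)"

lemma homeomorphic_Polish_space:
  assumes "P homeomorphic_space Q"
  shows "Polish_space P \<longleftrightarrow> Polish_space Q"
  using assms homeomorphic_completely_metrizable_space homeomorphic_separable_space
  unfolding Polish_space_def by blast

lemma Polish_space_iff_homeomorphic:
  fixes P :: "'a topology"
  shows "Polish_space P \<longleftrightarrow>
    (\<exists>(M :: 'a set) d. Metric_space M d \<and> Metric_space.mcomplete M d \<and>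
       separable_space (Metric_space.mtopology M d) \<and>
       P homeomorphic_space Metric_space.mtopology M d)"
proof
  assume "Polish_space P"
  then show "\<exists>(M :: 'a set) d. Metric_space M d \<and> Metric_space.mcomplete M d \<and>
       separable_space (Metric_space.mtopology M d) \<and>
       P homeomorphic_space Metric_space.mtopology M d"
    unfolding Polish_space_def completely_metrizable_space_def
    using homeomorphic_space_refl by blast
next
  assume "\<exists>(M :: 'a set) d. Metric_space M d \<and> Metric_space.mcomplete M d \<and>
       separable_space (Metric_space.mtopology M d) \<and>
       P homeomorphic_space Metric_space.mtopology M d"
  then obtain M d where "Metric_space M d" "Metric_space.mcomplete M d"
    "separable_space (Metric_space.mtopology M d)"
    and hom: "P homeomorphic_space Metric_space.mtopology (M :: 'a set) d" by blast
  then have "Polish_space (Metric_space.mtopology M d)"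
    unfolding Polish_space_def completely_metrizable_space_def by blast
  then show "Polish_space P"
    using homeomorphic_Polish_space[OF hom] by blast
qed

lemma fsigma_Lusin_spaceI:
  fixes P :: "'p topology" and X :: "'a topology"
  assumes P: "Polish_space P" and f: "fsigma_Lusin_map P X f"
  shows "fsigma_Lusin_space X"
proof -
  have bij: "bij_betw f (topspace P) (topspace X)" and cont: "continuous_map P X f"
    and meas: "\<And>U. openin P U \<Longrightarrow> fsigma_in X (f ` U)"
    using f by (auto simp: fsigma_Lusin_map_def)
  define g where "g = inv_into (topspace P) f"
  have gf: "g (f p) = p" if "p \<in> topspace P" for p
    using bij that by (simp add: g_def bij_betw_inv_into_left)
  have fg: "f (g x) = x" "g x \<in> topspace P" if "x \<in> topspace X" for x
    using bij that bij_betwE[OF bij_betw_inv_into[OF bij]]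
    by (simp_all add: g_def bij_betw_inv_into_right)
  define Q where "Q = pullback_topology (topspace X) g P"
  have topQ: "topspace Q = topspace X"
    using fg unfolding Q_def topspace_pullback_topology by auto
  have img: "f ` U = g -` U \<inter> topspace X" if "U \<subseteq> topspace P" for U
  proof
    show "f ` U \<subseteq> g -` U \<inter> topspace X"
      using that gf bij by (auto simp: bij_betw_def subset_iff)
    show "g -` U \<inter> topspace X \<subseteq> f ` U"
      using fg by (metis IntD1 IntD2 image_eqI subsetI vimage_eq)
  qed
  have openQ: "openin Q V \<longleftrightarrow> (\<exists>U. openin P U \<and> V = f ` U)" for V
    unfolding Q_def openin_pullback_topology using img openin_subset by metis
  have gimg: "g ` f ` U = U" if "U \<subseteq> topspace P" for U
    using that gf by (force simp: image_image subset_iff)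
  have "homeomorphic_maps Q P g f"
    unfolding homeomorphic_maps_def
  proof (intro conjI ballI)
    show "continuous_map Q P g"
      unfolding continuous_map_def
    proof (intro conjI allI impI)
      show "g \<in> topspace Q \<rightarrow> topspace P" using topQ fg by auto
      fix U assume U: "openin P U"
      have "{x \<in> topspace Q. g x \<in> U} = f ` U"
        using img[OF openin_subset[OF U]] topQ by auto
      then show "openin Q {x \<in> topspace Q. g x \<in> U}" using openQ U by auto
    qed
    show "continuous_map P Q f"
      unfolding continuous_map_def
    proof (intro conjI allI impI)
      show "f \<in> topspace P \<rightarrow> topspace Q" using topQ bij by (auto simp: bij_betw_def)
      fix V assume "openin Q V"
      then obtain U where U: "openin P U" "V = f ` U" using openQ by blast
      have "{x \<in> topspace P. f x \<in> V} = U"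
        using U(2) openin_subset[OF U(1)] bij by (auto simp: bij_betw_def inj_on_def)
      then show "openin P {x \<in> topspace P. f x \<in> V}" using U by simp
    qed
    show "f (g x) = x" if "x \<in> topspace Q" for x using fg topQ that by auto
    show "g (f x) = x" if "x \<in> topspace P" for x using gf that .
  qed
  then have hom: "Q homeomorphic_space P" and contg: "continuous_map Q P g"
    by (auto simp: homeomorphic_space_def homeomorphic_maps_def)
  have "continuous_map Q X id"
    using continuous_map_compose[OF contg cont] fg(1)
    by (auto simp: topQ intro: continuous_map_eq)
  moreover have "bij_betw id (topspace Q) (topspace X)" using topQ by simp
  moreover have "fsigma_in X (id ` V)" if "openin Q V" for V
    using that openQ meas by auto
  ultimately have "fsigma_Lusin_map Q X id" by (simp add: fsigma_Lusin_map_def)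
  moreover have "Polish_space Q" using homeomorphic_Polish_space[OF hom] P by blast
  ultimately show ?thesis unfolding fsigma_Lusin_space_def by blast
qed

end

theory Submission
  imports Defs
begin

text \<open>
  Let \<open>f : P \<rightarrow> X\<close> be the bijection from the Polish space \<open>P\<close>, with complete metric \<open>d\<close>. Since \<open>P\<close>
  is separable, countably many balls of radius \<open>1/(n+1)\<close> cover it; their images are
  \<open>F\<^sub>\<sigma>\<close>-sets in \<open>X\<close>, so \<open>X\<close> has a countable cover \<open>\<F>\<^sub>n\<close> by sets that are closed in \<open>X\<close> and
  have small preimages (lemma \<open>fsigma_Lusin_map_small_closed_cover\<close>).

  Closures in \<open>Y\<close> turn each cover into an \<open>F\<^sub>\<sigma>\<close>-set \<open>\<Union>C\<in>\<F>\<^sub>n. cl C\<close> containing \<open>X\<close>; let \<open>B\<close> be the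
  intersection of these over all \<open>n\<close>. A point \<open>y\<close> of \<open>B\<close> lies, for each \<open>n\<close>, in the closure of
  some \<open>C\<^sub>n \<in> \<F>\<^sub>n\<close>, but the sets \<open>C\<^sub>n\<close> need not be compatible with one another. To force
  them to meet, discard from \<open>Y\<close> the closed set \<open>cl C \<inter> cl D\<close> for each of the countably many pairs
  of disjoint members of \<open>\<Union>n. \<F>\<^sub>n\<close>. As \<open>C\<close> and \<open>D\<close> are closed in \<open>X\<close>, nothing of \<open>X\<close> is lost, and
  what remains is a \<open>G\<^sub>\<delta>\<close>-set \<open>A\<close>.

  For \<open>y \<in> A \<inter> B\<close> the sets \<open>C\<^sub>n\<close> meet pairwise, so the balls that contain their preimages
  have centres forming a Cauchy sequence, and these balls shrink to a point \<open>p\<close>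
  (lemma \<open>mcomplete_shrinking_balls\<close>). If \<open>y\<close> and \<open>f p\<close> were different, they would have disjoint
  neighbourhoods; by continuity \<open>C\<^sub>n\<close> lies in the neighbourhood of \<open>f p\<close> for large \<open>n\<close>, so
  \<open>y\<close> could not belong to its closure. Hence \<open>y = f p \<in> X\<close>.
\<close>

section \<open>Constructible, open and closed sets\<close>

lemma constructible_in_openin: "openin Y U \<Longrightarrow> constructible_in Y U"
  by (auto simp: constructible_in_def)

lemma constructible_in_closedin:
  assumes "closedin Y C"
  shows "constructible_in Y C"
  unfolding constructible_in_def
proof clarify
  fix M
  assume alg: "algebra (topspace Y) M" and sub: "{U. openin Y U} \<subseteq> M"
  have "topspace Y - (topspace Y - C) \<in> M"
    using algebra.compl_sets[OF alg] sub assms by (auto simp: closedin_def)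
  then show "C \<in> M"
    using closedin_subset[OF assms] by (simp add: double_diff)
qed

lemma csigma_in_openin: "openin Y U \<Longrightarrow> csigma_in Y U"
  by (simp add: csigma_in_def constructible_in_openin countable_union_of_inc)

lemma csigma_in_fsigma_in: "fsigma_in Y S \<Longrightarrow> csigma_in Y S"
  unfolding csigma_in_def fsigma_in_def union_of_def
  using constructible_in_closedin by blast

lemma csigma_delta_in_gdelta_Int_fsigma_delta:
  assumes "gdelta_in Y A" "fsigma_delta_in Y B"
  shows "csigma_delta_in Y (A \<inter> B)"
proof -
  obtain \<U> where \<U>: "countable \<U>" "\<And>U. U \<in> \<U> \<Longrightarrow> openin Y U" "A = topspace Y \<inter> \<Inter>\<U>"
    using assms(1) by (auto simp: gdelta_in_def relative_to_def intersection_of_def)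
  obtain \<V> where \<V>: "countable \<V>" "\<And>V. V \<in> \<V> \<Longrightarrow> fsigma_in Y V" "B = topspace Y \<inter> \<Inter>\<V>"
    using assms(2) by (auto simp: fsigma_delta_in_def relative_to_def intersection_of_def)
  have "countable (\<U> \<union> \<V>)" "\<U> \<union> \<V> \<subseteq> Collect (csigma_in Y)"
    using \<U>(1,2) \<V>(1,2) csigma_in_openin[of Y] csigma_in_fsigma_in[of Y] by blast+
  then have "(countable intersection_of csigma_in Y) (\<Inter>(\<U> \<union> \<V>))"
    unfolding intersection_of_def by (intro exI[of _ "\<U> \<union> \<V>"]) (simp only: simp_thms)
  moreover have "A \<inter> B = topspace Y \<inter> \<Inter>(\<U> \<union> \<V>)"
    using \<U>(3) \<V>(3) by auto
  ultimately show ?thesis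
    by (auto simp: csigma_delta_in_def relative_to_def)
qed

section \<open>Shrinking balls in a complete metric space\<close>

text \<open>
  Pairwise intersection, which is weaker than a common point of finitely many balls, already
  bounds the distance of two centres by the sum of the radii and so makes them Cauchy.
\<close>
lemma (in Metric_space) mcomplete_shrinking_balls:
  fixes r :: "nat \<Rightarrow> real"
  assumes "mcomplete"
    and meet: "\<And>m n. mball (c m) (r m) \<inter> mball (c n) (r n) \<noteq> {}"
    and r: "r \<longlonglongrightarrow> 0"
  obtains p where "p \<in> M"
    and "\<And>U. openin mtopology U \<Longrightarrow> p \<in> U \<Longrightarrow> eventually (\<lambda>n. mball (c n) (r n) \<subseteq> U) sequentially"
proof -
  have c: "c n \<in> M" for n
    using meet[of n n] by auto
  have dist: "d (c m) (c n) < r m + r n" for m n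
  proof -
    obtain z where z: "z \<in> mball (c m) (r m)" "z \<in> mball (c n) (r n)"
      using meet[of m n] by blast
    then have "d (c m) (c n) \<le> d (c m) z + d (c n) z"
      by (metis triangle commute in_mball)
    with z show ?thesis by (simp add: in_mball)
  qed
  have small: "\<exists>N. \<forall>n\<ge>N. r n < e" if "e > 0" for e
    using order_tendstoD(2)[OF r that] by (simp add: eventually_sequentially)
  have "MCauchy c"
    unfolding MCauchy_def
  proof (intro conjI allI impI)
    show "range c \<subseteq> M" using c by auto
    fix e :: real assume "e > 0"
    then obtain N where N: "\<forall>n\<ge>N. r n < e / 2"
      using small[of "e/2"] by auto
    have "d (c n) (c n') < e" if "N \<le> n" "N \<le> n'" for n n'
      using dist[of n n'] N[rule_format, OF that(1)] N[rule_format, OF that(2)] by linarith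
    then show "\<exists>N. \<forall>n n'. N \<le> n \<longrightarrow> N \<le> n' \<longrightarrow> d (c n) (c n') < e"
      by blast
  qed
  then obtain p where p: "limitin mtopology c p sequentially"
    using \<open>mcomplete\<close> by (auto simp: mcomplete_def)
  then have pM: "p \<in> M" by (simp add: limitin_mspace)
  show thesis
  proof (rule that[OF pM])
    fix U assume "openin mtopology U" "p \<in> U"
    then obtain e where e: "e > 0" "mball p e \<subseteq> U"
      by (auto simp: openin_mtopology)
    have "eventually (\<lambda>n. c n \<in> M \<and> d (c n) p < e / 2) sequentially"
      using p half_gt_zero[OF e(1)] unfolding limitin_metric in_mball by blast
    moreover have "eventually (\<lambda>n. r n < e / 2) sequentially"
      using order_tendstoD(2)[OF r half_gt_zero[OF e(1)]] .
    ultimately show "eventually (\<lambda>n. mball (c n) (r n) \<subseteq> U) sequentially"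
    proof eventually_elim
      case (elim n)
      have "mball (c n) (r n) \<subseteq> mball p e"
      proof
        fix z assume z: "z \<in> mball (c n) (r n)"
        have "d p z \<le> d p (c n) + d (c n) z"
          using z pM by (intro triangle) auto
        also have "\<dots> < e"
          using z elim commute[of p "c n"] by auto
        finally show "z \<in> mball p e" using z pM by auto
      qed
      with e(2) show ?case by blast
    qed
  qed
qed

section \<open>Closed covers with small preimages and the sets built from them\<close>

lemma (in Metric_space) separable_countable_ball_cover:
  assumes "separable_space mtopology" "e > 0"
  obtains D where "countable D" "D \<subseteq> M" "(\<Union>c\<in>D. mball c e) = M"
proof -
  obtain D where D: "countable D" "D \<subseteq> M" "mtopology closure_of D = M"
    using assms(1) by (auto simp: separable_space_def)
  have "x \<in> (\<Union>c\<in>D. mball c e)" if "x \<in> M" for x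
  proof -
    have "x \<in> mtopology closure_of D" using that D(3) by simp
    then obtain c where "c \<in> D" "c \<in> mball x e"
      using assms(2) by (auto simp: metric_closure_of)
    then show ?thesis by (auto simp: commute)
  qed
  then have "(\<Union>c\<in>D. mball c e) = M" by auto
  with D that show thesis by blast
qed

text \<open>
  Here \<open>F\<^sub>\<sigma>\<close>-measurability enters: the image of a ball need not be closed, but it splits
  into countably many closed pieces, and each piece inherits the small preimage.
\<close>
lemma (in Metric_space) fsigma_Lusin_map_small_closed_cover:
  assumes f: "fsigma_Lusin_map mtopology X f"
    and sep: "separable_space mtopology" and "e > 0"
  shows "\<exists>\<F>. countable \<F> \<and> (\<forall>C\<in>\<F>. closedin X C) \<and> \<Union>\<F> = topspace X \<and>
             (\<forall>C\<in>\<F>. \<exists>c. C \<subseteq> f ` mball c e)"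
proof -
  obtain D where D: "countable D" "D \<subseteq> M" "(\<Union>c\<in>D. mball c e) = M"
    using separable_countable_ball_cover[OF sep \<open>e > 0\<close>] .
  have "\<exists>\<C>. countable \<C> \<and> \<C> \<subseteq> Collect (closedin X) \<and> \<Union>\<C> = f ` mball c e" for c
    using f by (auto simp: fsigma_Lusin_map_def fsigma_in_def union_of_def)
  then obtain \<C> where \<C>: "\<And>c. countable (\<C> c)" "\<And>c. \<C> c \<subseteq> Collect (closedin X)"
    "\<And>c. \<Union>(\<C> c) = f ` mball c e"
    by metis
  have "f ` M = topspace X"
    using f by (auto simp: fsigma_Lusin_map_def bij_betw_def)
  moreover have "\<Union>(\<Union>c\<in>D. \<C> c) = (\<Union>c\<in>D. f ` mball c e)"
    unfolding \<C>(3)[symmetric] by auto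
  ultimately have "\<Union>(\<Union>c\<in>D. \<C> c) = topspace X"
    using D(3) by (metis image_UN)
  moreover have "countable (\<Union>c\<in>D. \<C> c)"
    using \<C>(1) D(1) by blast
  moreover have "closedin X C" "\<exists>c. C \<subseteq> f ` mball c e" if "C \<in> (\<Union>c\<in>D. \<C> c)" for C
  proof -
    from that obtain c where "C \<in> \<C> c" by blast
    then have "closedin X C" "C \<subseteq> f ` mball c e"
      using \<C>(2)[of c] \<C>(3)[of c] by blast+
    then show "closedin X C" "\<exists>c. C \<subseteq> f ` mball c e"
      by blast+
  qed
  ultimately show ?thesis
    by (intro exI[of _ "\<Union>c\<in>D. \<C> c"] conjI ballI)
qed

text \<open>
  A pair of disjoint members \<open>C\<close>, \<open>D\<close> excludes exactly the points of the closed set \<open>cl C \<inter> cl D\<close>,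
  and there are only countably many such pairs.
\<close>
lemma gdelta_in_avoiding_disjoint_closures:
  assumes "countable \<F>"
  shows "gdelta_in Y {y \<in> topspace Y. \<forall>C\<in>\<F>. \<forall>D\<in>\<F>.
           y \<in> Y closure_of C \<and> y \<in> Y closure_of D \<longrightarrow> C \<inter> D \<noteq> {}}"
    (is "gdelta_in Y ?A")
proof -
  define \<U> where "\<U> = (\<lambda>(C, D). topspace Y - (Y closure_of C \<inter> Y closure_of D)) `
                        {(C, D) \<in> \<F> \<times> \<F>. C \<inter> D = {}}"
  have "countable {(C, D) \<in> \<F> \<times> \<F>. C \<inter> D = {}}"
    by (rule countable_subset[OF _ countable_SIGMA[OF assms assms]]) auto
  then have "countable \<U>" by (simp add: \<U>_def)
  moreover have "\<U> \<subseteq> Collect (openin Y)"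
    by (auto simp: \<U>_def intro!: openin_diff closedin_Int)
  ultimately have "(countable intersection_of openin Y) (\<Inter>\<U>)"
    by (auto simp: intersection_of_def)
  moreover have "?A = topspace Y \<inter> \<Inter>\<U>"
    by (auto simp: \<U>_def)
  ultimately show ?thesis
    by (auto simp: gdelta_in_def relative_to_def)
qed

lemma fsigma_delta_in_closures:
  fixes \<F> :: "nat \<Rightarrow> 'a set set"
  assumes "\<And>n. countable (\<F> n)"
  shows "fsigma_delta_in Y (\<Inter>n. \<Union>C\<in>\<F> n. Y closure_of C)"
proof -
  have "fsigma_in Y (\<Union>C\<in>\<F> n. Y closure_of C)" for n
    using assms by (intro fsigma_in_Union) (auto intro: closed_imp_fsigma_in)
  then have "(countable intersection_of fsigma_in Y) (\<Inter>n. \<Union>C\<in>\<F> n. Y closure_of C)"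
    unfolding intersection_of_def
    by (intro exI[of _ "range (\<lambda>n. \<Union>C\<in>\<F> n. Y closure_of C)"]) auto
  moreover have "(\<Inter>n. \<Union>C\<in>\<F> n. Y closure_of C) \<subseteq> topspace Y"
    using closure_of_subset_topspace[of Y] by blast
  ultimately show ?thesis
    unfolding fsigma_delta_in_def relative_to_def by (meson inf.absorb2)
qed

section \<open>\<open>F\<^sub>\<sigma>\<close>-Lusin subspaces of Hausdorff spaces\<close>

theorem theorem3p1:
  fixes Y :: "'a topology" and X :: "'a set"
  assumes "Hausdorff_space Y"
    and "X \<subseteq> topspace Y"
    and "fsigma_Lusin_space (subtopology Y X)"
  shows "csigma_delta_in Y X \<and>
         (\<exists>A B. gdelta_in Y A \<and> fsigma_delta_in Y B \<and> X = A \<inter> B)"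
proof -
  obtain P :: "'a topology" and f where "Polish_space P"
    and f: "fsigma_Lusin_map P (subtopology Y X) f"
    using assms(3) by (auto simp: fsigma_Lusin_space_def)
  then obtain M d where "Metric_space M d" and complete: "Metric_space.mcomplete M d"
    and P: "P = Metric_space.mtopology M d" and sep: "separable_space P"
    by (auto simp: Polish_space_def completely_metrizable_space_def)
  interpret Metric_space M d by fact
  have topX: "topspace (subtopology Y X) = X"
    using assms(2) by auto
  have cont: "continuous_map P Y f" and fX: "\<And>p. p \<in> M \<Longrightarrow> f p \<in> X"
    using f P assms(2) unfolding fsigma_Lusin_map_def
    by (auto simp: continuous_map_in_subtopology bij_betw_def)
  define r :: "nat \<Rightarrow> real" where "r n = inverse (real (Suc n))" for n
  have "\<forall>n. \<exists>\<F>. countable \<F> \<and> (\<forall>C\<in>\<F>. closedin (subtopology Y X) C) \<and> \<Union>\<F> = X \<and>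
             (\<forall>C\<in>\<F>. \<exists>c. C \<subseteq> f ` mball c (r n))"
    using fsigma_Lusin_map_small_closed_cover[of "subtopology Y X" f] f sep topX
    by (simp add: P r_def)
  then obtain \<F> where \<F>: "\<And>n. countable (\<F> n)"
      "\<And>n C. C \<in> \<F> n \<Longrightarrow> closedin (subtopology Y X) C" "\<And>n. \<Union>(\<F> n) = X"
    and ball: "\<And>n C. C \<in> \<F> n \<Longrightarrow> \<exists>c. C \<subseteq> f ` mball c (r n)"
    by metis
  define A where "A = {y \<in> topspace Y. \<forall>C\<in>\<Union>(range \<F>). \<forall>D\<in>\<Union>(range \<F>).
                        y \<in> Y closure_of C \<and> y \<in> Y closure_of D \<longrightarrow> C \<inter> D \<noteq> {}}"
  define B where "B = (\<Inter>n. \<Union>C\<in>\<F> n. Y closure_of C)"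
  have A: "gdelta_in Y A"
    unfolding A_def using \<F>(1) by (intro gdelta_in_avoiding_disjoint_closures) auto
  have B: "fsigma_delta_in Y B"
    unfolding B_def using \<F>(1) by (rule fsigma_delta_in_closures)
  have clos: "X \<inter> Y closure_of C = C" if "C \<in> \<F> n" for n C
  proof -
    have "C \<subseteq> X" using closedin_subset[OF \<F>(2)[OF that]] topX by simp
    then show "X \<inter> Y closure_of C = C"
      using closure_of_closedin[OF \<F>(2)[OF that]]
      by (simp add: closure_of_subtopology Int_absorb1)
  qed
  have "X \<subseteq> A"
    using clos assms(2) unfolding A_def by blast
  moreover have "X \<subseteq> B"
  proof
    fix x assume x: "x \<in> X"
    have "\<exists>C\<in>\<F> n. x \<in> Y closure_of C" for n
    proof -
      obtain C where "C \<in> \<F> n" "x \<in> C" using x \<F>(3) by blast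
      then show ?thesis using clos by blast
    qed
    then show "x \<in> B" by (simp add: B_def)
  qed
  moreover have "y \<in> X" if y: "y \<in> A" "y \<in> B" for y
  proof -
    have "\<forall>n. \<exists>C c. C \<in> \<F> n \<and> y \<in> Y closure_of C \<and> C \<subseteq> f ` mball c (r n)"
      using y(2) ball by (fastforce simp: B_def)
    then obtain C c where C: "\<And>n. C n \<in> \<F> n" "\<And>n. y \<in> Y closure_of (C n)"
      and c: "\<And>n. C n \<subseteq> f ` mball (c n) (r n)"
      by metis
    \<comment> \<open>The images of the balls meet by the choice of \<open>A\<close>; injectivity of \<open>f\<close> carries this back to the balls.\<close>
    have inj: "inj_on f M"
      using f by (simp add: fsigma_Lusin_map_def bij_betw_def P)
    have meet: "mball (c m) (r m) \<inter> mball (c n) (r n) \<noteq> {}" for m n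
    proof -
      have "C m \<inter> C n \<noteq> {}"
        using y(1) C unfolding A_def by blast
      then have "f ` mball (c m) (r m) \<inter> f ` mball (c n) (r n) \<noteq> {}"
        using c[of m] c[of n] by blast
      then show ?thesis
        using inj_on_image_Int[OF inj, of "mball (c m) (r m)" "mball (c n) (r n)"]
          mball_subset_mspace by auto
    qed
    have "r \<longlonglongrightarrow> 0"
      unfolding r_def by (rule LIMSEQ_inverse_real_of_nat)
    from mcomplete_shrinking_balls[OF complete meet this]
    obtain p where p: "p \<in> M" and shrink:
      "\<And>U. openin P U \<Longrightarrow> p \<in> U \<Longrightarrow> eventually (\<lambda>n. mball (c n) (r n) \<subseteq> U) sequentially"
      unfolding P by blast
    have "y = f p"
    proof (rule ccontr)
      assume "y \<noteq> f p"
      moreover have "y \<in> topspace Y" "f p \<in> topspace Y"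
        using y(1) fX[OF p] assms(2) by (auto simp: A_def)
      ultimately obtain W V where WV: "openin Y W" "openin Y V" "y \<in> W" "f p \<in> V" "disjnt W V"
        using assms(1) unfolding Hausdorff_space_def by metis
      have "openin P {q \<in> topspace P. f q \<in> V}"
        using cont WV(2) by (rule openin_continuous_map_preimage)
      from shrink[OF this] obtain n where "mball (c n) (r n) \<subseteq> {q \<in> topspace P. f q \<in> V}"
        using p WV(4) by (auto simp: P eventually_sequentially)
      then have "C n \<subseteq> V" using c[of n] by blast
      moreover have "\<exists>z. z \<in> C n \<and> z \<in> W"
        using C(2)[of n] WV(1,3) by (auto simp: in_closure_of)
      ultimately show False
        using WV(5) by (auto simp: disjnt_iff)
    qed
    then show ?thesis using fX p by simp
  qed
  ultimately have X: "X = A \<inter> B" by blast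
  show ?thesis
    using csigma_delta_in_gdelta_Int_fsigma_delta[OF A B] A B X by auto
qed

end
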